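(* Let $B$ be a length-$n$, width-$w$, read-once, oblivious, regular branching program. Let $k$ be a positive integer and let $T$ be a random variable over $\{0,1\}^n$ where each bit has expectation $p$ and the bits are $\delta$-almost $2k$-wise independent. Suppose $p\le(2w)^{-2}$ and $\delta\le(2w)^{-4k}$. Then $$\mathbb{P}_T\left[L_2(B|_T)\le(2w^2)^k\right]\ge 1-n^4\cdot\frac{2}{2^k}.$$
   Context: Write $[w]=\{1,\dots,w\}$. A length-$n$, width-$w$ program is a function $B:\{0,1\}^n\times[w]\to[w]$, written $B[x](u)$; it is identified with the matrix-valued function $x\mapsto B[x]\in\{0,1\}^{w\times w}$ where $B[x](u,v)=1$ iff $B[x](u)=v$. Concatenation of programs: $(B\circ B')[x\circ x']=B[x]\cdot B'[x']$ (matrix product). A length-$n$, width-$w$ ordered branching program is a program $B=B_1\circ\cdots\circ B_n$ with each layer $B_i$ a length-1, width-$w$ program. A read-once, oblivious branching program is a function of the form $B[x]=B'[\pi(x)]$ where $B'$ is an ordered branching program, $\pi$ is a permutation of $[n]$, and the $i$-th bit of $\pi(x)$ is the $\pi(i)$-th bit of $x$. It is regular if, for every layer $B'_i$, the matrix $\mathbb{E}_{U}[B'_i[U]]$ ($U$ a uniform bit) is doubly stochastic. Strings in $\{0,1\}^n$ are identified with subsets of $[n]$. For $F:\{0,1\}^n\to\mathbb{R}^{w\times w}$ and $s\in\{0,1\}^n$, $\widehat F[s]=\mathbb{E}_U[F[U]\chi_s(U)]$ with $U$ uniform on $\{0,1\}^n$ and $\chi_s(x)=(-1)^{\sum_i x_is_i}$.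 $\|A\|_2$ is the spectral norm, and $L_2(F)=\sum_{s\ne0}\|\widehat F[s]\|_2$. For $t\subset[n]$, $x\in\{0,1\}^n$ and $y$ a string of length at least $n-|t|$, $\mathrm{Select}(t,x,y)\in\{0,1\}^n$ has $i$-th bit $x_i$ if $i\in t$ and $y_{|[i]\setminus t|}$ if $i\notin t$. The restriction $B|_t:\{0,1\}^n\to\mathbb{R}^{w\times w}$ is $B|_t[x]=\mathbb{E}_U[B[\mathrm{Select}(t,x,U)]]$, $U$ uniform on $\{0,1\}^n$. A random variable $X$ on $\Omega^n$ is $\delta$-almost $k$-wise independent if for any $I=\{i_1,\dots,i_k\}\subset[n]$ with $|I|=k$ and any $S\subset\Omega^k$, $\left|\sum_{x\in S}\left(\mathbb{P}[(X_{i_1},\dots,X_{i_k})=x]-\prod_{l\in[k]}\mathbb{P}[X_{i_l}=x_l]\right)\right|\le\delta$. *)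

theory Defs
  imports "HOL-Probability.Probability" "HOL-Combinatorics.Permutations"
begin

text \<open>
  Bit strings are lists of booleans, with positions counted from 0; the state space \<open>[w]\<close>
  is a finite type \<open>'w\<close> with \<open>w = CARD('w)\<close>. Functions on \<open>{0,1}\<^sup>n\<close> are functions on all
  lists, of which only the values on \<open>bitstrings n\<close> matter.
\<close>

definition bitstrings :: "nat \<Rightarrow> bool list set" where
  "bitstrings n = {x. length x = n}"

lemma bitstrings_eq: "bitstrings n = {x. set x \<subseteq> UNIV \<and> length x = n}"
  by (simp add: bitstrings_def)

lemma finite_bitstrings [simp]: "finite (bitstrings n)"
  unfolding bitstrings_eq by (rule finite_lists_length_eq) simp

lemma card_bitstrings [simp]: "card (bitstrings n) = 2 ^ n"
  using card_lists_length_eq[of "UNIV :: bool set" n] by (simp add: bitstrings_eq)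

lemma bitstrings_nonempty [simp]: "bitstrings n \<noteq> {}"
  using length_replicate[of n False] by (auto simp: bitstrings_def simp del: length_replicate)

definition unif_expectation :: "nat \<Rightarrow> (bool list \<Rightarrow> 'b::{banach, second_countable_topology}) \<Rightarrow> 'b" where
  "unif_expectation n F = measure_pmf.expectation (pmf_of_set (bitstrings n)) F"

lemma unif_expectation_eq:
  "unif_expectation n F = (1 / 2 ^ n) *\<^sub>R (\<Sum>x\<in>bitstrings n. F x)"
  unfolding unif_expectation_def
  by (subst integral_measure_pmf[of "bitstrings n"]) (auto simp: scaleR_sum_right)


type_synonym 'w prog = "bool list \<Rightarrow> 'w \<Rightarrow> 'w"

definition transition_matrix :: "('w::finite \<Rightarrow> 'w) \<Rightarrow> real^'w^'w" where
  "transition_matrix f = (\<chi> u v. of_bool (f u = v))"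

definition prog_matrix :: "('w::finite) prog \<Rightarrow> bool list \<Rightarrow> real^'w^'w" where
  "prog_matrix B x = transition_matrix (B x)"

text \<open>Here \<open>m\<close> is the length of the first program \<open>B\<close>.\<close>

definition prog_concat :: "nat \<Rightarrow> 'w prog \<Rightarrow> 'w prog \<Rightarrow> 'w prog" where
  "prog_concat m B B' z = (\<lambda>u. B' (drop m z) (B (take m z) u))"

lemma prog_matrix_concat:
  assumes "length x = m"
  shows "prog_matrix (prog_concat m B B') (x @ x') = prog_matrix B x ** prog_matrix B' x'"
  using assms
  by (simp add: prog_matrix_def transition_matrix_def prog_concat_def matrix_matrix_mult_def
      vec_eq_iff of_bool_def if_distrib[of "\<lambda>a. a * _"] cong: if_cong)

text \<open>The ordered branching program with the given list of length-1 layers.\<close>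

fun ordered_prog :: "'w prog list \<Rightarrow> 'w prog" where
  "ordered_prog [] = (\<lambda>x u. u)"
| "ordered_prog (L # Ls) = prog_concat 1 L (ordered_prog Ls)"

definition doubly_stochastic :: "real^'w^'w \<Rightarrow> bool" where
  "doubly_stochastic A \<longleftrightarrow>
     (\<forall>u v. 0 \<le> A $ u $ v) \<and> (\<forall>u. (\<Sum>v\<in>UNIV. A $ u $ v) = 1) \<and> (\<forall>v. (\<Sum>u\<in>UNIV. A $ u $ v) = 1)"

definition regular_layer :: "('w::finite) prog \<Rightarrow> bool" where
  "regular_layer L \<longleftrightarrow> doubly_stochastic (unif_expectation 1 (prog_matrix L))"

text \<open>The entry of \<open>permute_list \<pi> x\<close> at position \<open>i\<close> is the entry of \<open>x\<close> at position \<open>\<pi> i\<close>.\<close>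

definition read_once_oblivious_regular :: "nat \<Rightarrow> ('w::finite) prog \<Rightarrow> bool" where
  "read_once_oblivious_regular n B \<longleftrightarrow>
     (\<exists>Ls \<pi>. length Ls = n \<and> (\<forall>L\<in>set Ls. regular_layer L) \<and> \<pi> permutes {..<n} \<and>
        (\<forall>x\<in>bitstrings n. B x = ordered_prog Ls (permute_list \<pi> x)))"


definition character :: "bool list \<Rightarrow> bool list \<Rightarrow> real" where
  "character s x = (-1) ^ (\<Sum>i<length s. of_bool (x ! i) * of_bool (s ! i))"

definition fourier :: "nat \<Rightarrow> (bool list \<Rightarrow> real^'w^'w) \<Rightarrow> bool list \<Rightarrow> real^'w^('w::finite)" where
  "fourier n F s = unif_expectation n (\<lambda>x. character s x *\<^sub>R F x)"

definition spectral_norm :: "real^'w^'w \<Rightarrow> real" where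
  "spectral_norm A = onorm (\<lambda>v. A *v v)"

definition L2_mass :: "nat \<Rightarrow> (bool list \<Rightarrow> real^'w^('w::finite)) \<Rightarrow> real" where
  "L2_mass n F = (\<Sum>s\<in>bitstrings n - {replicate n False}. spectral_norm (fourier n F s))"

text \<open>
  A string \<open>t\<close> is read as the set of positions where it is \<open>True\<close>. Positions being counted
  from 0, the entry \<open>|[i] \ t|\<close> of \<open>y\<close> becomes the one at the number of positions below \<open>i\<close>
  outside \<open>t\<close>.
\<close>

definition select :: "bool list \<Rightarrow> bool list \<Rightarrow> bool list \<Rightarrow> bool list" where
  "select t x y =
     map (\<lambda>i. if t ! i then x ! i else y ! card {j. j < i \<and> \<not> t ! j}) [0..<length t]"

definition restriction ::
  "nat \<Rightarrow> (bool list \<Rightarrow> real^'w^'w) \<Rightarrow> bool list \<Rightarrow> bool list \<Rightarrow> real^'w^('w::finite)" where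
  "restriction n F t x = unif_expectation n (\<lambda>y. F (select t x y))"


text \<open>
  The index set \<open>{i\<^sub>1, \<dots>, i\<^sub>k}\<close> is given by a list \<open>ixs\<close> enumerating it; the order is immaterial
  because \<open>S\<close> is arbitrary.
\<close>

definition (in prob_space) almost_indep_bits ::
  "real \<Rightarrow> nat \<Rightarrow> nat \<Rightarrow> ('a \<Rightarrow> bool list) \<Rightarrow> bool" where
  "almost_indep_bits \<delta> k n X \<longleftrightarrow>
     (\<forall>ixs S. distinct ixs \<and> set ixs \<subseteq> {..<n} \<and> length ixs = k \<and> S \<subseteq> bitstrings k \<longrightarrow>
        \<bar>\<Sum>x\<in>S. prob {\<omega> \<in> space M. map (\<lambda>i. X \<omega> ! i) ixs = x}
                - (\<Prod>l<k. prob {\<omega> \<in> space M. X \<omega> ! (ixs ! l) = x ! l})\<bar> \<le> \<delta>)"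

end

theory Submission
  imports Defs
begin

text \<open>
  Restricting to \<open>T\<close> keeps exactly the Fourier coefficients supported in \<open>T\<close>, and the coefficients
  of an ordered program are products of coefficients of its layers. A potential argument bounds by
  \<open>2 w\<^sup>2\<close> the sum over \<open>i\<close> of the norms of the coefficients of \<open>B\<^sub>i \<circ> \<dots> \<circ> B\<^sub>n\<close> at \<open>10\<dots>0\<close>; splitting
  off the last 1 of a frequency then bounds the mass at level \<open>j\<close>, the frequencies of Hamming
  weight \<open>j\<close>, by \<open>(2 w\<^sup>2)\<^sup>j\<close>. For \<open>k \<le> j < 2 k\<close> the restricted mass at level \<open>j\<close> of a subprogram is at
  most \<open>2 / 2\<^sup>j\<close> in expectation, so by Markov's inequality and a union bound all of these masses are
  at most \<open>1/n\<close> except with probability \<open>n\<^sup>4 \<cdot> 2 / 2\<^sup>k\<close>. In that event the same bound holds at every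
  level \<open>j \<ge> 2 k\<close>, by induction: splitting off the last \<open>k\<close> ones gives at most \<open>n \<cdot> 1/n \<cdot> 1/n\<close>. Levels
  below \<open>k\<close> contribute at most the geometric sum of the \<open>(2 w\<^sup>2)\<^sup>j\<close>. If \<open>n < 2 k\<close>, the independence
  hypothesis is void, but there are at most \<open>4\<^sup>k\<close> coefficients, each of norm at most 1, and
  they all vanish at nonzero frequencies when \<open>w = 1\<close>.
\<close>

subsection \<open>Restrictions and permutations\<close>

lemma bitstrings_0 [simp]: "bitstrings 0 = {[]}"
  by (auto simp: bitstrings_def)

lemma bitstrings_Suc: "bitstrings (Suc n) = (#) False ` bitstrings n \<union> (#) True ` bitstrings n"
  by (auto simp: bitstrings_def length_Suc_conv image_iff)

lemma sum_bitstrings_Suc: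
  fixes f :: "bool list \<Rightarrow> 'a::comm_monoid_add"
  shows "(\<Sum>x\<in>bitstrings (Suc n). f x) =
    (\<Sum>x\<in>bitstrings n. f (False # x)) + (\<Sum>x\<in>bitstrings n. f (True # x))"
  unfolding bitstrings_Suc
  by (subst sum.union_disjoint) (auto simp: sum.reindex)

lemma length_bitstrings: "x \<in> bitstrings n \<Longrightarrow> length x = n"
  by (simp add: bitstrings_def)

lemma character_Nil [simp]: "character [] x = 1"
  by (simp add: character_def)

lemma character_Cons [simp]:
  "character (b # s) (c # x) = (if b \<and> c then -1 else 1) * character s x"
  by (simp add: character_def sum.lessThan_Suc_shift power_add del: sum.lessThan_Suc)

lemma character_permute:
  assumes "\<pi> permutes {..<n}" "length s = n" "length x = n"
  shows "character (permute_list \<pi> s) (permute_list \<pi> x) = character s x"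
proof -
  have "(\<Sum>i<n. of_bool (permute_list \<pi> x ! i) * of_bool (permute_list \<pi> s ! i)) =
      (\<Sum>i<n. of_bool (x ! \<pi> i) * (of_bool (s ! \<pi> i) :: nat))"
    using assms by (intro sum.cong) (auto simp: permute_list_nth)
  also have "\<dots> = (\<Sum>i<n. of_bool (x ! i) * of_bool (s ! i))"
    using sum.permute[OF assms(1), of "\<lambda>i. of_bool (x ! i) * (of_bool (s ! i) :: nat)"]
    by (simp add: o_def)
  finally show ?thesis
    using assms(2,3) by (simp only: character_def length_permute_list)
qed

lemma bij_betw_permute_list:
  assumes "\<pi> permutes {..<n}"
  shows "bij_betw (permute_list \<pi>) (bitstrings n) (bitstrings n)"
proof (rule bij_betw_byWitness[where f' = "permute_list (inv \<pi>)"])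
  have inv: "inv \<pi> permutes {..<n}"
    using assms by (rule permutes_inv)
  show "\<forall>x\<in>bitstrings n. permute_list (inv \<pi>) (permute_list \<pi> x) = x"
    using inv by (simp add: permute_list_compose[symmetric] length_bitstrings permutes_inv_o[OF assms])
  show "\<forall>x\<in>bitstrings n. permute_list \<pi> (permute_list (inv \<pi>) x) = x"
    using assms by (simp add: permute_list_compose[symmetric] length_bitstrings permutes_inv_o[OF assms])
qed (auto simp: bitstrings_def)

text \<open>Permuting positions maps uniform inputs to uniform inputs, and a character is unchanged
  when both of its arguments are permuted. So the order of reading only relabels the
  frequencies.\<close>

lemma fourier_permute:
  assumes "\<pi> permutes {..<n}" "s \<in> bitstrings n"
    and "\<And>x. x \<in> bitstrings n \<Longrightarrow> F x = G (permute_list \<pi> x)"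
  shows "fourier n F s = fourier n G (permute_list \<pi> s)"
proof -
  have "(\<Sum>x\<in>bitstrings n. character s x *\<^sub>R F x) =
      (\<Sum>x\<in>bitstrings n. character (permute_list \<pi> s) (permute_list \<pi> x) *\<^sub>R G (permute_list \<pi> x))"
    by (rule sum.cong) (use assms in \<open>auto simp: character_permute length_bitstrings\<close>)
  also have "\<dots> = (\<Sum>x\<in>bitstrings n. character (permute_list \<pi> s) x *\<^sub>R G x)"
    by (rule sum.reindex_bij_betw[OF bij_betw_permute_list[OF assms(1)]])
  finally show ?thesis
    by (simp add: fourier_def unif_expectation_eq)
qed

text \<open>With the next lemma this turns the counting index of \<open>select\<close> into a
  recursion: a kept position leaves \<open>y\<close> intact, a freed one consumes its head.\<close>

lemma select_Cons_True: "select (True # t) (c # x) y = c # select t x y"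
proof -
  have "{j. j < Suc i \<and> \<not> (True # t) ! j} = Suc ` {j. j < i \<and> \<not> t ! j}" for i
    by (rule set_eqI, case_tac x) auto
  then show ?thesis
    unfolding select_def
    by (simp add: upt_conv_Cons map_Suc_upt[symmetric] card_image o_def del: upt_Suc)
qed

lemma select_Cons_False: "select (False # t) (c # x) (d # y) = d # select t x y"
proof -
  have "{j. j < Suc i \<and> \<not> (False # t) ! j} = insert 0 (Suc ` {j. j < i \<and> \<not> t ! j})" for i
    by (rule set_eqI, case_tac x) auto
  then show ?thesis
    unfolding select_def
    by (simp add: upt_conv_Cons map_Suc_upt[symmetric] card_image o_def del: upt_Suc)
qed

text \<open>Induction over positions. At a freed position the restricted function ignores the bit of
  \<open>x\<close>: a frequency bit 1 there makes two equal sums cancel, a frequency bit 0 adds them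
  up to the full sum. Kept positions consume nothing of \<open>y\<close>, hence the general length
  \<open>m\<close>.\<close>

lemma sum_character_restriction:
  fixes F :: "bool list \<Rightarrow> 'b::real_vector"
  assumes "length s = length t" "length t \<le> m"
  shows "(\<Sum>x\<in>bitstrings (length t). character s x *\<^sub>R
            ((1 / 2 ^ m) *\<^sub>R (\<Sum>y\<in>bitstrings m. F (select t x y)))) =
         of_bool (list_all2 (\<longrightarrow>) s t) *\<^sub>R (\<Sum>x\<in>bitstrings (length t). character s x *\<^sub>R F x)"
  using assms
proof (induction t arbitrary: s m F)
  case Nil
  then show ?case
    by (simp add: select_def sum_constant_scaleR)
next
  case (Cons a t)
  obtain b s' where s: "s = b # s'" and len: "length s' = length t"
    using Cons.prems(1) by (cases s) auto
  define G where "G c = (\<Sum>x\<in>bitstrings (length t). character s' x *\<^sub>R F (c # x))" for c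
  show ?case
  proof (cases a)
    case True
    have *: "(\<Sum>x\<in>bitstrings (length t). character s (c # x) *\<^sub>R
            ((1 / 2 ^ m) *\<^sub>R (\<Sum>y\<in>bitstrings m. F (select (a # t) (c # x) y)))) =
          (if b \<and> c then -1 else 1) *\<^sub>R of_bool (list_all2 (\<longrightarrow>) s' t) *\<^sub>R G c" for c
    proof -
      have "length t \<le> m"
        using Cons.prems(2) by simp
      from Cons.IH[OF len this, of "\<lambda>x. F (c # x)"] show ?thesis
        using True
        by (simp only: s G_def select_Cons_True character_Cons scaleR_scaleR[symmetric] scaleR_sum_right[symmetric, of "if _ then _ else _"])
    qed
    show ?thesis
      using True unfolding length_Cons sum_bitstrings_Suc *
      by (simp add: s G_def sum_negf scaleR_right_distrib)
  next
    case False
    obtain m' where m: "m = Suc m'" and m': "length t \<le> m'"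
      using Cons.prems(2) by (cases m) auto
    have "(\<Sum>x\<in>bitstrings (length t). character s' x *\<^sub>R
            ((1 / 2 ^ m) *\<^sub>R (\<Sum>y\<in>bitstrings m. F (select (a # t) (c # x) y)))) =
          (1 / 2) *\<^sub>R of_bool (list_all2 (\<longrightarrow>) s' t) *\<^sub>R (G False + G True)" (is "?A c = _") for c
    proof -
      have *: "character s' x *\<^sub>R ((1 / 2 ^ m) *\<^sub>R (\<Sum>y\<in>bitstrings m. F (select (a # t) (c # x) y))) =
          (1 / 2) *\<^sub>R (character s' x *\<^sub>R ((1 / 2 ^ m') *\<^sub>R (\<Sum>y\<in>bitstrings m'. F (False # select t x y))) +
            character s' x *\<^sub>R ((1 / 2 ^ m') *\<^sub>R (\<Sum>y\<in>bitstrings m'. F (True # select t x y))))" for x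
        using False by (simp add: m sum_bitstrings_Suc select_Cons_False scaleR_right_distrib mult.commute)
      show ?thesis
        unfolding * scaleR_sum_right[symmetric] sum.distrib Cons.IH[OF len m', of "\<lambda>x. F (_ # x)"]
        by (simp add: G_def scaleR_right_distrib)
    qed
    then have *: "(\<Sum>x\<in>bitstrings (length t). character s (c # x) *\<^sub>R
            ((1 / 2 ^ m) *\<^sub>R (\<Sum>y\<in>bitstrings m. F (select (a # t) (c # x) y)))) =
          (if b \<and> c then -1 else 1) *\<^sub>R (1 / 2) *\<^sub>R of_bool (list_all2 (\<longrightarrow>) s' t) *\<^sub>R (G False + G True)" for c
      by (simp add: s sum_negf)
    have half: "(1/2) *\<^sub>R v + (1/2) *\<^sub>R v = v" for v :: 'b
      using scaleR_left_distrib[of "1/2" "1/2" v] by simp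
    show ?thesis
      using False unfolding length_Cons sum_bitstrings_Suc *
      by (simp add: s half G_def)
  qed
qed

lemma fourier_restriction:
  assumes "s \<in> bitstrings n" "t \<in> bitstrings n"
  shows "fourier n (restriction n F t) s = of_bool (list_all2 (\<longrightarrow>) s t) *\<^sub>R fourier n F s"
  using sum_character_restriction[of s t n F] assms
  by (simp add: fourier_def restriction_def unif_expectation_eq length_bitstrings)

subsection \<open>Fourier coefficients of regular programs\<close>

lemma spectral_norm_nonneg [simp]: "0 \<le> spectral_norm A"
  by (simp add: spectral_norm_def onorm_pos_le)

lemma spectral_norm_mult: "spectral_norm (A ** B) \<le> spectral_norm A * spectral_norm B"
  using onorm_compose[of "\<lambda>v. A *v v" "\<lambda>v. B *v v"]
  by (simp add: spectral_norm_def o_def matrix_vector_mul_assoc)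

lemma spectral_norm_leI:
  assumes "\<And>v. norm (A *v v) \<le> c * norm v"
  shows "spectral_norm A \<le> c"
  unfolding spectral_norm_def using assms by (rule onorm_le)

lemma spectral_norm_0 [simp]: "spectral_norm 0 = 0"
  by (simp add: spectral_norm_def onorm_zero)

text \<open>The operator norm is at most the sum of the absolute entries. Grouping them by columns,
  the images of the unit vectors, fits the potential argument, which follows one vector at a
  time.\<close>

lemma spectral_norm_le_sum_columns:
  "spectral_norm A \<le> (\<Sum>v\<in>UNIV. \<Sum>u\<in>UNIV. \<bar>(A *v axis v 1) $ u\<bar>)"
proof -
  have "spectral_norm A \<le> (\<Sum>u\<in>UNIV. \<Sum>v\<in>UNIV. \<bar>A $ u $ v\<bar>)"
    unfolding spectral_norm_def by (rule onorm_le_matrix_component_sum)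
  also have "\<dots> = (\<Sum>v\<in>UNIV. \<Sum>u\<in>UNIV. \<bar>A $ u $ v\<bar>)"
    by (rule sum.swap)
  finally show ?thesis
    by (simp add: matrix_vector_mult_basis column_def)
qed

lemma matrix_mult_sum_right:
  fixes A :: "'a::semiring_1^'n^'m"
  shows "A ** (\<Sum>x\<in>S. f x) = (\<Sum>x\<in>S. A ** f x)"
  by (induction S rule: infinite_finite_induct) (auto simp: matrix_add_ldistrib)

lemma scaleR_matrix_mult:
  fixes A :: "real^'n^'m" and B :: "real^'k^'n"
  shows "(a *\<^sub>R A) ** (b *\<^sub>R B) = (a * b) *\<^sub>R (A ** B)"
  by (simp add: vec_eq_iff matrix_matrix_mult_def sum_distrib_left mult_ac)

section \<open>Coefficients as products over the layers\<close>

definition layer_coeff :: "('w::finite) prog \<Rightarrow> bool \<Rightarrow> real^'w^'w" where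
  "layer_coeff L b = fourier 1 (prog_matrix L) [b]"

lemma layer_coeff_eq:
  "layer_coeff L b =
    (1 / 2) *\<^sub>R (prog_matrix L [False] + (if b then -1 else 1) *\<^sub>R prog_matrix L [True])"
  by (simp add: layer_coeff_def fourier_def unif_expectation_eq sum_bitstrings_Suc)

text \<open>The recursion runs over the layers and ignores surplus bits of \<open>s\<close>. It
  gives Fourier coefficients when \<open>s\<close> has one bit per layer.\<close>

primrec path_coeff :: "('w::finite) prog list \<Rightarrow> bool list \<Rightarrow> real^'w^'w" where
  "path_coeff [] s = mat 1"
| "path_coeff (L # Ls) s = layer_coeff L (hd s) ** path_coeff Ls (tl s)"

lemma path_coeff_append:
  assumes "length s = length Ls"
  shows "path_coeff (Ls @ Ls') (s @ s') = path_coeff Ls s ** path_coeff Ls' s'"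
  using assms by (induction Ls arbitrary: s) (auto simp: length_Suc_conv matrix_mul_assoc)

text \<open>Characters and program matrices are both multiplicative under concatenation, so the
  average over independent bits factors into one average per layer.\<close>

lemma fourier_ordered_prog:
  assumes "s \<in> bitstrings (length Ls)"
  shows "fourier (length Ls) (prog_matrix (ordered_prog Ls)) s = path_coeff Ls s"
  using assms
proof (induction Ls arbitrary: s)
  case Nil
  then show ?case
    by (simp add: fourier_def unif_expectation_eq prog_matrix_def transition_matrix_def mat_def
        vec_eq_iff)
next
  case (Cons L Ls)
  obtain b s' where s: "s = b # s'" and s': "s' \<in> bitstrings (length Ls)"
    using Cons.prems by (cases s) (auto simp: bitstrings_def)
  let ?P = "\<lambda>x. character s' x *\<^sub>R prog_matrix (ordered_prog Ls) x"
  have concat: "prog_matrix (ordered_prog (L # Ls)) (c # x) =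
      prog_matrix L [c] ** prog_matrix (ordered_prog Ls) x" for c x
    using prog_matrix_concat[of "[c]" 1] by simp
  have *: "(\<Sum>x\<in>bitstrings (length Ls). character s (c # x) *\<^sub>R
        prog_matrix (ordered_prog (L # Ls)) (c # x)) =
      ((if b \<and> c then -1 else 1) *\<^sub>R prog_matrix L [c]) ** (\<Sum>x\<in>bitstrings (length Ls). ?P x)" for c
    unfolding matrix_mult_sum_right scaleR_matrix_mult concat s character_Cons ..
  have "fourier (length (L # Ls)) (prog_matrix (ordered_prog (L # Ls))) s =
      ((1 / 2) *\<^sub>R (prog_matrix L [False] + (if b then -1 else 1) *\<^sub>R prog_matrix L [True])) **
      ((1 / 2 ^ length Ls) *\<^sub>R (\<Sum>x\<in>bitstrings (length Ls). ?P x))"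
    unfolding fourier_def unif_expectation_eq length_Cons sum_bitstrings_Suc * scaleR_matrix_mult
    by (simp add: matrix_matrix_mult_def vec_eq_iff algebra_simps sum.distrib)
  also have "\<dots> = path_coeff (L # Ls) s"
    using Cons.IH[OF s'] by (simp add: s layer_coeff_eq fourier_def unif_expectation_eq)
  finally show ?case .
qed

lemma layer_coeff_vec:
  "(layer_coeff L b *v f) $ u =
    (f $ (L [False] u) + (if b then -1 else 1) * f $ (L [True] u)) / 2"
proof -
  have "(prog_matrix L x *v f) $ u = f $ (L x u)" for x
    by (simp add: prog_matrix_def transition_matrix_def matrix_vector_mult_def of_bool_def
        if_distrib[of "\<lambda>a. a * _"] cong: if_cong)
  then show ?thesis
    by (simp add: layer_coeff_eq matrix_vector_mult_add_rdistrib scaleR_matrix_vector_assoc[symmetric])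
qed

text \<open>Column sums equal to 1 say that every state is entered by exactly two edges. Counting
  the edges by their ends instead of their starts gives the identity.\<close>

lemma regular_layer_sum:
  fixes h :: "'w::finite \<Rightarrow> real"
  assumes "regular_layer L"
  shows "(\<Sum>u\<in>UNIV. h (L [False] u) + h (L [True] u)) = 2 * (\<Sum>v\<in>UNIV. h v)"
proof -
  have col: "(\<Sum>u\<in>UNIV. of_bool (L [False] u = v) + of_bool (L [True] u = v)) = (2 :: real)" for v
  proof -
    have "(\<Sum>u\<in>UNIV. unif_expectation 1 (prog_matrix L) $ u $ v) = 1"
      using assms by (simp add: regular_layer_def doubly_stochastic_def)
    then show ?thesis
      by (simp add: unif_expectation_eq sum_bitstrings_Suc prog_matrix_def transition_matrix_def
          flip: sum_divide_distrib del: sum_of_bool_eq)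
  qed
  have pick: "h x = (\<Sum>v\<in>UNIV. of_bool (x = v) * h v)" for x
    by (simp add: of_bool_def if_distrib[of "\<lambda>a. a * _"] cong: if_cong)
  have "(\<Sum>u\<in>UNIV. h (L [False] u) + h (L [True] u)) =
      (\<Sum>u\<in>UNIV. \<Sum>v\<in>UNIV. (of_bool (L [False] u = v) + of_bool (L [True] u = v)) * h v)"
    by (subst (1 2) pick) (simp add: sum.distrib distrib_right)
  also have "\<dots> = (\<Sum>v\<in>UNIV. \<Sum>u\<in>UNIV. (of_bool (L [False] u = v) + of_bool (L [True] u = v)) * h v)"
    by (rule sum.swap)
  also have "\<dots> = (\<Sum>v\<in>UNIV. 2 * h v)"
    by (simp only: sum_distrib_right[symmetric] col)
  finally show ?thesis
    by (simp add: sum_distrib_left)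
qed

text \<open>Each entry of the image is half the sum or half the difference of two values of
  \<open>f\<close>. Convexity of the square bounds its square by their mean square, and regularity
  makes these means add up to the squared norm of \<open>f\<close>.\<close>

lemma spectral_norm_layer_coeff:
  assumes "regular_layer L"
  shows "spectral_norm (layer_coeff L b) \<le> 1"
proof (rule spectral_norm_leI)
  fix f
  have sq: "(norm g)\<^sup>2 = (\<Sum>u\<in>UNIV. (g $ u)\<^sup>2)" for g :: "real^'a"
    by (simp only: power2_norm_eq_inner inner_vec_def) (simp add: power2_eq_square)
  have "((x + (if b then -1 else 1) * y) / 2)\<^sup>2 \<le> (x\<^sup>2 + y\<^sup>2) / 2" for x y :: real
    using sum_power2_ge_zero[of "x + y" 0] sum_power2_ge_zero[of "x - y" 0]
    by (auto simp: power2_eq_square field_simps)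
  then have "(norm (layer_coeff L b *v f))\<^sup>2 \<le>
      (\<Sum>u\<in>UNIV. ((f $ (L [False] u))\<^sup>2 + (f $ (L [True] u))\<^sup>2) / 2)"
    unfolding sq layer_coeff_vec by (intro sum_mono)
  also have "\<dots> = (norm f)\<^sup>2"
    unfolding sq sum_divide_distrib[symmetric]
    using regular_layer_sum[OF assms, of "\<lambda>v. (f $ v)\<^sup>2"] by simp
  finally show "norm (layer_coeff L b *v f) \<le> 1 * norm f"
    by (simp add: power2_le_iff_abs_le)
qed

lemma spectral_norm_path_coeff:
  assumes "\<forall>L\<in>set Ls. regular_layer L"
  shows "spectral_norm (path_coeff Ls s) \<le> 1"
  using assms
proof (induction Ls arbitrary: s)
  case Nil
  show ?case
    by (rule spectral_norm_leI) simp
next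
  case (Cons L Ls)
  have "spectral_norm (path_coeff (L # Ls) s) \<le>
      spectral_norm (layer_coeff L (hd s)) * spectral_norm (path_coeff Ls (tl s))"
    by (simp add: spectral_norm_mult)
  also have "\<dots> \<le> 1 * 1"
    using Cons by (intro mult_mono spectral_norm_layer_coeff) auto
  finally show ?case
    by simp
qed

section \<open>A potential that decreases along regular layers\<close>

definition spread :: "real^'w \<Rightarrow> real" where
  "spread f = (\<Sum>u\<in>UNIV. \<Sum>v\<in>UNIV. \<bar>f $ u - f $ v\<bar>)"

lemma spread_nonneg: "0 \<le> spread f"
  by (simp add: spread_def sum_nonneg)

lemma spread_axis: "spread (axis v 1 :: real^'w) = 2 * (real CARD('w::finite) - 1)"
proof -
  \<comment> \<open>For a, b in {0,1} one has |a - b| = a + b - 2ab, which makes the double sum over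
    ordered pairs computable.\<close>
  have "\<bar>(axis v 1 :: real^'w) $ a - axis v 1 $ b\<bar> =
      of_bool (a = v) + of_bool (b = v) - 2 * (of_bool (a = v) * of_bool (b = v))" for a b
    by (auto simp: axis_def)
  then have "spread (axis v 1 :: real^'w) = (\<Sum>a\<in>(UNIV::'w set). \<Sum>b\<in>(UNIV::'w set).
      of_bool (a = v) + of_bool (b = v) - 2 * (of_bool (a = v) * of_bool (b = v)))"
    by (simp add: spread_def)
  also have "\<dots> = 2 * (real CARD('w) - 1)"
    by (simp add: sum.distrib sum_subtractf sum_distrib_left[symmetric] sum_distrib_right[symmetric])
  finally show ?thesis .
qed

text \<open>
  By regularity every state is entered by exactly two edges, so the sum of \<open>\<bar>f x - f y\<bar>\<close> over
  all ordered pairs of edges, with ends \<open>x\<close> and \<open>y\<close>, is \<open>4 * spread f\<close>. The four pairs starting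
  in distinct \<open>u\<close>, \<open>u'\<close> pay for the difference of the averages at \<open>u\<close> and \<open>u'\<close>; the pairs
  starting in the same \<open>u\<close> are left over and pay for the coefficient of frequency 1.
\<close>

lemma spread_layer:
  assumes "regular_layer L"
  shows "(\<Sum>u\<in>UNIV. \<bar>(layer_coeff L True *v f) $ u\<bar>) + spread (layer_coeff L False *v f)
    \<le> spread f"
proof -
  define h0 h1 where "h0 u = f $ (L [False] u)" and "h1 u = f $ (L [True] u)" for u
  define d e where "d u = (h0 u + h1 u) / 2" and "e u = (h0 u - h1 u) / 2" for u
  have double: "(\<Sum>u'\<in>UNIV. \<bar>x - h0 u'\<bar> + \<bar>x - h1 u'\<bar>) = 2 * (\<Sum>v\<in>UNIV. \<bar>x - f $ v\<bar>)" for x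
    unfolding h0_def h1_def using regular_layer_sum[OF assms, of "\<lambda>v. \<bar>x - f $ v\<bar>"] by simp
  have "4 * (of_bool (u = u') * \<bar>e u\<bar> + \<bar>d u - d u'\<bar>) \<le>
      (\<bar>h0 u - h0 u'\<bar> + \<bar>h0 u - h1 u'\<bar>) + (\<bar>h1 u - h0 u'\<bar> + \<bar>h1 u - h1 u'\<bar>)" for u u'
    unfolding d_def e_def by (cases "u = u'") (auto simp: abs_if field_simps)
  then have "(\<Sum>u\<in>UNIV. \<Sum>u'\<in>UNIV. 4 * (of_bool (u = u') * \<bar>e u\<bar> + \<bar>d u - d u'\<bar>)) \<le>
      (\<Sum>u\<in>UNIV. \<Sum>u'\<in>UNIV. (\<bar>h0 u - h0 u'\<bar> + \<bar>h0 u - h1 u'\<bar>) + (\<bar>h1 u - h0 u'\<bar> + \<bar>h1 u - h1 u'\<bar>))"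
    by (intro sum_mono)
  also have "\<dots> = 2 * (\<Sum>u\<in>UNIV. (\<Sum>v\<in>UNIV. \<bar>h0 u - f $ v\<bar>) + (\<Sum>v\<in>UNIV. \<bar>h1 u - f $ v\<bar>))"
    unfolding sum.distrib[of _ _ UNIV, where g = "\<lambda>u'. \<bar>h0 _ - h0 u'\<bar> + \<bar>h0 _ - h1 u'\<bar>"] double
    by (simp add: sum_distrib_left)
  also have "\<dots> = 4 * spread f"
    unfolding h0_def h1_def regular_layer_sum[OF assms, of "\<lambda>u. \<Sum>v\<in>UNIV. \<bar>f $ u - f $ v\<bar>"]
    by (simp add: spread_def)
  finally have "(\<Sum>u\<in>UNIV. \<bar>e u\<bar>) + (\<Sum>u\<in>UNIV. \<Sum>u'\<in>UNIV. \<bar>d u - d u'\<bar>) \<le> spread f"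
    by (simp add: sum.distrib sum_distrib_left[symmetric] of_bool_def if_distrib[of "\<lambda>a. a * _"] cong: if_cong)
  moreover have "(layer_coeff L True *v f) $ u = e u" "(layer_coeff L False *v f) $ u = d u" for u
    by (auto simp: layer_coeff_vec d_def e_def h0_def h1_def)
  ultimately show ?thesis
    by (simp add: spread_def)
qed

text \<open>Telescoping: layers act on \<open>f\<close> from the last to the first, and each pays
  for its coefficient at 1, applied to the average through the later layers, with the loss of
  potential that its averaging causes.\<close>

lemma spread_path:
  assumes "\<forall>L\<in>set Ls. regular_layer L"
  shows "(\<Sum>m<length Ls. \<Sum>u\<in>UNIV.
      \<bar>(path_coeff (drop m Ls) (True # replicate (length Ls - Suc m) False) *v f) $ u\<bar>) +
    spread (path_coeff Ls (replicate (length Ls) False) *v f) \<le> spread f"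
  using assms
proof (induction Ls)
  case (Cons L Ls)
  define g where "g = path_coeff Ls (replicate (length Ls) False) *v f"
  have "(\<Sum>u\<in>UNIV. \<bar>(layer_coeff L True *v g) $ u\<bar>) + spread (layer_coeff L False *v g) \<le> spread g"
    using Cons.prems by (intro spread_layer) simp
  with Cons show ?case
    by (simp add: sum.lessThan_Suc_shift g_def matrix_vector_mul_assoc del: sum.lessThan_Suc)
qed simp

text \<open>Each of the w unit vectors starts with potential 2 (w - 1). The factor w - 1 makes the
  bound vanish for a single state, which the treatment of short programs exploits.\<close>

lemma sum_spectral_norm_first:
  fixes Ls :: "('w::finite) prog list"
  assumes "\<forall>L\<in>set Ls. regular_layer L"
  shows "(\<Sum>m<length Ls. spectral_norm
      (path_coeff (drop m Ls) (True # replicate (length Ls - Suc m) False))) \<le>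
    2 * real CARD('w) * (real CARD('w) - 1)"
proof -
  let ?A = "\<lambda>m. path_coeff (drop m Ls) (True # replicate (length Ls - Suc m) False)"
  have "(\<Sum>m<length Ls. spectral_norm (?A m)) \<le>
      (\<Sum>m<length Ls. \<Sum>v\<in>UNIV. \<Sum>u\<in>UNIV. \<bar>(?A m *v axis v 1) $ u\<bar>)"
    by (intro sum_mono spectral_norm_le_sum_columns)
  also have "\<dots> = (\<Sum>v\<in>UNIV. \<Sum>m<length Ls. \<Sum>u\<in>UNIV. \<bar>(?A m *v axis v 1) $ u\<bar>)"
    by (rule sum.swap)
  also have "\<dots> \<le> (\<Sum>v\<in>(UNIV::'w set). 2 * (real CARD('w) - 1))"
  proof (rule sum_mono)
    fix v :: 'w
    show "(\<Sum>m<length Ls. \<Sum>u\<in>UNIV. \<bar>(?A m *v axis v 1) $ u\<bar>) \<le> 2 * (real CARD('w) - 1)"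
      using spread_path[OF assms, of "axis v 1"] spread_nonneg[of "path_coeff Ls (replicate (length Ls) False) *v axis v 1"]
      by (simp add: spread_axis)
  qed
  finally show ?thesis
    by (simp add: algebra_simps)
qed

subsection \<open>Fourier mass by level\<close>

definition strings_of_weight :: "nat \<Rightarrow> nat \<Rightarrow> bool list set" where
  "strings_of_weight n k = {s \<in> bitstrings n. count_list s True = k}"

lemma finite_strings_of_weight [simp]: "finite (strings_of_weight n k)"
  by (simp add: strings_of_weight_def)

lemma strings_of_weight_0: "strings_of_weight n 0 = {replicate n False}"
proof -
  have "x = replicate n False" if "length x = n" "True \<notin> set x" for x
    using that replicate_eqI[of x n False] by (metis (full_types))
  then show ?thesis
    by (auto simp: strings_of_weight_def bitstrings_def count_list_0_iff)
qed

lemma split_at_True: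
  assumes "count_list s True = j + Suc k"
  obtains s1 s2 where "s = s1 @ True # s2" "count_list s1 True = j" "count_list s2 True = k"
proof -
  have "\<exists>s1 s2. s = s1 @ True # s2 \<and> count_list s1 True = j \<and> count_list s2 True = k"
    using assms
  proof (induction s arbitrary: j)
    case (Cons a s)
    show ?case
    proof (cases "a \<and> j = 0")
      case True
      then show ?thesis
        using Cons.prems by (intro exI[of _ "[]"] exI[of _ s]) auto
    next
      case False
      then have "count_list s True = (j - of_bool a) + Suc k"
        using Cons.prems by (cases a; cases j) auto
      then obtain s1 s2 where "s = s1 @ True # s2" "count_list s1 True = j - of_bool a"
        "count_list s2 True = k"
        using Cons.IH by blast
      then show ?thesis
        using False by (intro exI[of _ "a # s1"] exI[of _ s2]) (cases a; cases j; auto)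
    qed
  qed simp
  then show ?thesis
    using that by blast
qed

text \<open>Cutting at the one preceded by exactly \<open>j\<close> ones shows that the triples (m,
  s1, s2) cover all strings of this weight. For nonnegative summands this covering gives the
  inequality.\<close>

lemma sum_strings_split:
  fixes f :: "bool list \<Rightarrow> real"
  assumes "\<And>s. 0 \<le> f s"
  shows "(\<Sum>s\<in>strings_of_weight n (j + Suc k). f s) \<le>
    (\<Sum>m<n. \<Sum>s1\<in>strings_of_weight m j. \<Sum>s2\<in>strings_of_weight (n - Suc m) k. f (s1 @ True # s2))"
proof -
  let ?g = "\<lambda>(m :: nat, s1, s2). s1 @ True # s2"
  let ?I = "SIGMA m:{..<n}. strings_of_weight m j \<times> strings_of_weight (n - Suc m) k"
  have fin: "finite ?I"
    by (intro finite_SigmaI) auto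
  have "strings_of_weight n (j + Suc k) \<subseteq> ?g ` ?I"
  proof
    fix s
    assume "s \<in> strings_of_weight n (j + Suc k)"
    then have s: "length s = n" "count_list s True = j + Suc k"
      by (auto simp: strings_of_weight_def bitstrings_def)
    from s(2) obtain s1 s2 where "s = s1 @ True # s2" "count_list s1 True = j" "count_list s2 True = k"
      by (rule split_at_True)
    with s(1) show "s \<in> ?g ` ?I"
      by (intro image_eqI[of _ _ "(length s1, s1, s2)"])
        (auto simp: strings_of_weight_def bitstrings_def)
  qed
  then have "(\<Sum>s\<in>strings_of_weight n (j + Suc k). f s) \<le> sum f (?g ` ?I)"
    using assms by (intro sum_mono2 finite_imageI fin) auto
  also have "\<dots> \<le> sum (f \<circ> ?g) ?I"
    using assms by (intro sum_image_le fin)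
  also have "\<dots> = (\<Sum>m<n. \<Sum>s1\<in>strings_of_weight m j. \<Sum>s2\<in>strings_of_weight (n - Suc m) k. f (s1 @ True # s2))"
    unfolding sum.cartesian_product by (subst sum.Sigma) (auto simp: case_prod_unfold)
  finally show ?thesis .
qed

lemma path_coeff_split:
  assumes "length s1 = m" "m \<le> length Ls"
  shows "spectral_norm (path_coeff Ls (s1 @ s2)) \<le>
    spectral_norm (path_coeff (take m Ls) s1) * spectral_norm (path_coeff (drop m Ls) s2)"
  using path_coeff_append[of s1 "take m Ls" "drop m Ls" s2] assms
  by (simp add: min_absorb2 spectral_norm_mult)

text \<open>Induction on the weight, cutting at the last one: the suffix frequency is then 10...0.
  The prefix sums are bounded uniformly in the cut \<open>m\<close>, so the suffix norms can be
  summed over \<open>m\<close>.\<close>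

lemma sum_spectral_norm_weight:
  fixes Ls :: "('w::finite) prog list"
  assumes "\<forall>L\<in>set Ls. regular_layer L"
  shows "(\<Sum>s\<in>strings_of_weight (length Ls) k. spectral_norm (path_coeff Ls s)) \<le>
    (2 * real CARD('w) * (real CARD('w) - 1)) ^ k"
  using assms
proof (induction k arbitrary: Ls)
  case 0
  then show ?case
    by (simp add: strings_of_weight_0 spectral_norm_path_coeff)
next
  case (Suc k)
  let ?c = "2 * real CARD('w) * (real CARD('w) - 1)"
  let ?first = "\<lambda>m. spectral_norm (path_coeff (drop m Ls) (True # replicate (length Ls - Suc m) False))"
  have c: "0 \<le> ?c"
    by (simp add: Suc_le_eq)
  have "(\<Sum>s\<in>strings_of_weight (length Ls) (Suc k). spectral_norm (path_coeff Ls s)) \<le>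
      (\<Sum>m<length Ls. \<Sum>s1\<in>strings_of_weight m k. \<Sum>s2\<in>strings_of_weight (length Ls - Suc m) 0.
        spectral_norm (path_coeff Ls (s1 @ True # s2)))"
    using sum_strings_split[of "\<lambda>s. spectral_norm (path_coeff Ls s)" "length Ls" k 0] by simp
  also have "\<dots> \<le> (\<Sum>m<length Ls. \<Sum>s1\<in>strings_of_weight m k.
      spectral_norm (path_coeff (take m Ls) s1) * ?first m)"
    by (auto simp: strings_of_weight_0 intro!: sum_mono path_coeff_split)
      (auto simp: strings_of_weight_def bitstrings_def)
  also have "\<dots> \<le> (\<Sum>m<length Ls. ?c ^ k * ?first m)"
  proof (rule sum_mono)
    fix m
    assume "m \<in> {..<length Ls}"
    then have "(\<Sum>s1\<in>strings_of_weight m k. spectral_norm (path_coeff (take m Ls) s1)) \<le> ?c ^ k"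
      using Suc.IH[of "take m Ls"] Suc.prems by (auto simp: min_absorb2 dest: in_set_takeD)
    then show "(\<Sum>s1\<in>strings_of_weight m k. spectral_norm (path_coeff (take m Ls) s1) * ?first m) \<le>
        ?c ^ k * ?first m"
      unfolding sum_distrib_right[symmetric] by (intro mult_right_mono) auto
  qed
  also have "\<dots> = ?c ^ k * (\<Sum>m<length Ls. ?first m)"
    by (simp add: sum_distrib_left)
  also have "\<dots> \<le> ?c ^ k * ?c"
    using c by (intro mult_left_mono sum_spectral_norm_first Suc.prems zero_le_power)
  finally show ?case
    by (simp add: mult.commute)
qed

text \<open>By \<open>fourier_restriction\<close> the coefficients that survive the restriction to
  \<open>t\<close> are those with frequency contained in \<open>t\<close>; this is their total norm
  at weight \<open>k\<close>.\<close>

definition level_mass :: "nat \<Rightarrow> ('w::finite) prog list \<Rightarrow> bool list \<Rightarrow> real" where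
  "level_mass k Ls t = (\<Sum>s\<in>strings_of_weight (length Ls) k.
     of_bool (list_all2 (\<longrightarrow>) s t) * spectral_norm (path_coeff Ls s))"

lemma level_mass_nonneg: "0 \<le> level_mass k Ls t"
  by (simp add: level_mass_def sum_nonneg)

lemma level_mass_le_sum:
  "level_mass k Ls t \<le> (\<Sum>s\<in>strings_of_weight (length Ls) k. spectral_norm (path_coeff Ls s))"
  unfolding level_mass_def by (intro sum_mono) auto

lemma sum_spectral_norm_weight_le:
  fixes Ls :: "('w::finite) prog list"
  assumes "\<forall>L\<in>set Ls. regular_layer L"
  shows "(\<Sum>s\<in>strings_of_weight (length Ls) k. spectral_norm (path_coeff Ls s)) \<le>
    (2 * real CARD('w) ^ 2) ^ k"
proof -
  have "1 \<le> real CARD('w)"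
    by (simp add: Suc_le_eq)
  then have "(2 * real CARD('w) * (real CARD('w) - 1)) ^ k \<le> (2 * real CARD('w) ^ 2) ^ k"
    by (intro power_mono) (auto simp: power2_eq_square)
  with sum_spectral_norm_weight[OF assms] show ?thesis
    by (rule order_trans)
qed

text \<open>The cut is made just before a one, which goes to the suffix: hence weight
  \<open>Suc k\<close> there. Containment in \<open>t\<close> splits along the cut, and norms are
  submultiplicative.\<close>

lemma level_mass_add_le:
  assumes "length t = length Ls"
  shows "level_mass (j + Suc k) Ls t \<le>
    (\<Sum>m<length Ls. level_mass j (take m Ls) (take m t) * level_mass (Suc k) (drop m Ls) (drop m t))"
proof -
  let ?f = "\<lambda>Ls t s. of_bool (list_all2 (\<longrightarrow>) s t) * spectral_norm (path_coeff Ls s)"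
  have "level_mass (j + Suc k) Ls t \<le>
      (\<Sum>m<length Ls. \<Sum>s1\<in>strings_of_weight m j. \<Sum>s2\<in>strings_of_weight (length Ls - Suc m) k.
        ?f Ls t (s1 @ True # s2))"
    unfolding level_mass_def by (rule sum_strings_split) simp
  also have "\<dots> \<le> (\<Sum>m<length Ls. level_mass j (take m Ls) (take m t) * level_mass (Suc k) (drop m Ls) (drop m t))"
  proof (rule sum_mono)
    fix m
    assume "m \<in> {..<length Ls}"
    then have m: "m < length Ls"
      by simp
    let ?T = "(#) True ` strings_of_weight (length Ls - Suc m) k"
    have "(\<Sum>s1\<in>strings_of_weight m j. \<Sum>s2\<in>strings_of_weight (length Ls - Suc m) k.
        ?f Ls t (s1 @ True # s2)) =
        (\<Sum>s1\<in>strings_of_weight m j. \<Sum>s2\<in>?T. ?f Ls t (s1 @ s2))"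
      by (subst sum.reindex) (simp_all only: o_def inj_on_def list.inject simp_thms ball_triv)
    also have "\<dots> \<le> (\<Sum>s1\<in>strings_of_weight m j. \<Sum>s2\<in>?T.
        ?f (take m Ls) (take m t) s1 * ?f (drop m Ls) (drop m t) s2)"
    proof (intro sum_mono)
      fix s1 s2
      assume "s1 \<in> strings_of_weight m j"
      then have s1: "length s1 = m"
        by (simp add: strings_of_weight_def bitstrings_def)
      have "list_all2 (\<longrightarrow>) (s1 @ s2) (take m t @ drop m t) \<longleftrightarrow>
          list_all2 (\<longrightarrow>) s1 (take m t) \<and> list_all2 (\<longrightarrow>) s2 (drop m t)"
        using s1 m assms by (intro list_all2_append) simp
      then show "?f Ls t (s1 @ s2) \<le> ?f (take m Ls) (take m t) s1 * ?f (drop m Ls) (drop m t) s2"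
        using path_coeff_split[OF s1, of Ls s2] m by simp
    qed
    \<comment> \<open>The suffixes in \<open>?T\<close> start with a one; nonnegativity allows
      passing to all suffixes of weight \<open>Suc k\<close>.\<close>
    also have "\<dots> \<le> (\<Sum>s1\<in>strings_of_weight m j. \<Sum>s2\<in>strings_of_weight (length Ls - m) (Suc k).
        ?f (take m Ls) (take m t) s1 * ?f (drop m Ls) (drop m t) s2)"
    proof -
      have "?T \<subseteq> strings_of_weight (length Ls - m) (Suc k)"
        using m by (auto simp: strings_of_weight_def bitstrings_def)
      then show ?thesis
        by (intro sum_mono sum_mono2 finite_strings_of_weight) auto
    qed
    also have "\<dots> = level_mass j (take m Ls) (take m t) * level_mass (Suc k) (drop m Ls) (drop m t)"
      using m by (simp only: level_mass_def sum_product length_take length_drop min_absorb2 less_imp_le)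
    finally show "(\<Sum>s1\<in>strings_of_weight m j. \<Sum>s2\<in>strings_of_weight (length Ls - Suc m) k.
        ?f Ls t (s1 @ True # s2)) \<le>
        level_mass j (take m Ls) (take m t) * level_mass (Suc k) (drop m Ls) (drop m t)" .
  qed
  finally show ?thesis .
qed

section \<open>From single levels to the total mass\<close>

lemma sum_nonzero_strings:
  fixes f :: "bool list \<Rightarrow> real"
  shows "(\<Sum>s\<in>bitstrings n - {replicate n False}. f s) = (\<Sum>k=1..n. \<Sum>s\<in>strings_of_weight n k. f s)"
proof -
  have "bitstrings n - {replicate n False} = (\<Union>k\<in>{1..n}. strings_of_weight n k)"
    unfolding strings_of_weight_0[symmetric]
    by (auto simp: strings_of_weight_def bitstrings_def Suc_le_eq intro: count_le_length)
  then show ?thesis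
    by (simp only:) (subst sum.UNION_disjoint, auto simp: strings_of_weight_def)
qed

text \<open>Permuting frequencies fixes the zero string and carries containment in \<open>t\<close>
  to containment in the permuted \<open>t\<close>, which reduces the mass to that of an ordered
  program.\<close>

lemma L2_mass_restriction:
  assumes \<pi>: "\<pi> permutes {..<n}" and len: "length Ls = n"
    and B: "\<forall>x\<in>bitstrings n. B x = ordered_prog Ls (permute_list \<pi> x)"
    and t: "t \<in> bitstrings n"
  shows "L2_mass n (restriction n (prog_matrix B) t) = (\<Sum>k=1..n. level_mass k Ls (permute_list \<pi> t))"
proof -
  let ?N = "{replicate n False}"
  let ?f = "\<lambda>s. of_bool (list_all2 (\<longrightarrow>) s (permute_list \<pi> t)) * spectral_norm (path_coeff Ls s)"
  have bij: "bij_betw (permute_list \<pi>) (bitstrings n - ?N) (bitstrings n - ?N)"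
  proof (rule bij_betw_DiffI)
    have "permute_list \<pi> (replicate n False) = replicate n False"
      using \<pi> permutes_in_image[OF \<pi>]
      by (intro nth_equalityI) (simp_all add: permute_list_nth)
    then show "bij_betw (permute_list \<pi>) ?N ?N"
      by (simp add: bij_betw_def)
  qed (use bij_betw_permute_list[OF \<pi>] in \<open>simp_all add: bitstrings_def\<close>)
  have "spectral_norm (fourier n (restriction n (prog_matrix B) t) s) = ?f (permute_list \<pi> s)"
    if s: "s \<in> bitstrings n" for s
  proof -
    have "fourier n (prog_matrix B) s =
        fourier n (prog_matrix (ordered_prog Ls)) (permute_list \<pi> s)"
      using B by (intro fourier_permute[OF \<pi> s]) (simp add: prog_matrix_def)
    also have "\<dots> = path_coeff Ls (permute_list \<pi> s)"
      using fourier_ordered_prog[of "permute_list \<pi> s" Ls] s len by (simp add: bitstrings_def)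
    finally show ?thesis
      using \<pi> s t by (simp add: fourier_restriction list_all2_permute_list_iff length_bitstrings)
  qed
  then have "L2_mass n (restriction n (prog_matrix B) t) =
      (\<Sum>s\<in>bitstrings n - ?N. ?f (permute_list \<pi> s))"
    unfolding L2_mass_def by (intro sum.cong) auto
  also have "\<dots> = (\<Sum>s\<in>bitstrings n - ?N. ?f s)"
    by (rule sum.reindex_bij_betw[OF bij])
  finally show ?thesis
    by (simp add: sum_nonzero_strings level_mass_def len)
qed

text \<open>The claim covers all infixes at once because prefixes and suffixes of infixes are again
  infixes. For j \<ge> 2k the level j - k is still at least k, so the induction hypothesis applies
  to the prefix.\<close>

lemma level_mass_tail:
  assumes len: "length Ls \<le> n" "length t = length Ls"
    and mid: "\<And>i l j. \<lbrakk>k \<le> j; j < 2 * k\<rbrakk> \<Longrightarrow>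
      level_mass j (take l (drop i Ls)) (take l (drop i t)) \<le> 1 / n"
    and "1 \<le> k" "k \<le> j"
  shows "level_mass j (take l (drop i Ls)) (take l (drop i t)) \<le> 1 / n"
  using \<open>k \<le> j\<close>
proof (induction j arbitrary: i l rule: less_induct)
  case (less j)
  show ?case
  proof (cases "j < 2 * k")
    case False
    define Ks s where "Ks = take l (drop i Ls)" and "s = take l (drop i t)"
    have prefix: "level_mass (j - k) (take m Ks) (take m s) \<le> 1 / n" for m
      using less.IH[of "j - k" "min m l" i] False \<open>1 \<le> k\<close> by (simp add: Ks_def s_def)
    have suffix: "level_mass k (drop m Ks) (drop m s) \<le> 1 / n" for m
      using mid[of k "l - m" "m + i"] \<open>1 \<le> k\<close> by (simp add: Ks_def s_def drop_take)
    have "level_mass j Ks s \<le>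
        (\<Sum>m<length Ks. level_mass (j - k) (take m Ks) (take m s) * level_mass k (drop m Ks) (drop m s))"
      using level_mass_add_le[of s Ks "j - k" "k - 1"] False \<open>1 \<le> k\<close> len
      by (simp add: Ks_def s_def)
    also have "\<dots> \<le> (\<Sum>m<length Ks. 1 / n * (1 / n))"
      using prefix suffix by (intro sum_mono mult_mono level_mass_nonneg) auto
    also have "\<dots> \<le> (\<Sum>m<n. 1 / n * (1 / n))"
      using len by (intro sum_mono2) (auto simp: Ks_def)
    also have "\<dots> \<le> 1 / n"
      by simp
    finally show ?thesis
      by (simp add: Ks_def s_def)
  qed (use mid less.prems in auto)
qed

lemma sum_powers_le:
  fixes a :: real
  assumes "2 \<le> a"
  shows "(\<Sum>j<k. a ^ j) \<le> a ^ k"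
proof (induction k)
  case (Suc k)
  have "2 * a ^ k \<le> a * a ^ k"
    using assms by (intro mult_right_mono) auto
  with Suc show ?case
    by simp
qed simp

lemma sum_level_mass_le:
  fixes Ls :: "('w::finite) prog list"
  assumes "\<forall>L\<in>set Ls. regular_layer L" "length t = length Ls" "1 \<le> k"
    and "\<And>i l j. \<lbrakk>k \<le> j; j < 2 * k\<rbrakk> \<Longrightarrow>
      level_mass j (take l (drop i Ls)) (take l (drop i t)) \<le> 1 / length Ls"
  shows "(\<Sum>j=1..length Ls. level_mass j Ls t) \<le> (2 * real CARD('w) ^ 2) ^ k"
proof -
  let ?n = "length Ls" and ?a = "2 * real CARD('w) ^ 2"
  have w: "1 \<le> real CARD('w)"
    by (simp add: Suc_le_eq)
  have a: "2 \<le> ?a"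
    using one_le_power[OF w, of 2] by simp
  have low: "level_mass j Ls t \<le> ?a ^ j" for j
    using level_mass_le_sum sum_spectral_norm_weight_le[OF assms(1)] by (rule order_trans)
  have high: "level_mass j Ls t \<le> 1 / ?n" if "k \<le> j" for j
    using level_mass_tail[of Ls ?n t k j ?n 0] assms that by simp
  have "(\<Sum>j=1..?n. level_mass j Ls t) \<le> (\<Sum>j=1..?n. (if j < k then ?a ^ j else 0) + 1 / ?n)"
    using low high by (intro sum_mono) (auto intro: add_increasing2)
  also have "\<dots> = (\<Sum>j\<in>{1..?n} \<inter> {..<k}. ?a ^ j) + (\<Sum>j=1..?n. 1 / ?n)"
    by (simp add: sum.distrib sum.inter_restrict[symmetric] lessThan_def sum.If_cases)
  \<comment> \<open>At most \<open>?n\<close> summands of \<open>1 / ?n\<close> contribute at most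
    1, which fills in the missing term \<open>?a ^ 0\<close> of the geometric sum.\<close>
  also have "\<dots> \<le> (\<Sum>j\<in>{..<k} - {0}. ?a ^ j) + 1"
    using a by (intro add_mono sum_mono2) auto
  also have "\<dots> = (\<Sum>j<k. ?a ^ j)"
    using \<open>1 \<le> k\<close> by (subst sum_diff) auto
  also have "\<dots> \<le> ?a ^ k"
    by (rule sum_powers_le) fact
  finally show ?thesis .
qed

lemma sum_level_mass_le_of_short:
  fixes Ls :: "('w::finite) prog list"
  assumes "\<forall>L\<in>set Ls. regular_layer L" "length Ls < 2 * k"
  shows "(\<Sum>j=1..length Ls. level_mass j Ls t) \<le> (2 * real CARD('w) ^ 2) ^ k"
proof (cases "CARD('w) = 1")
  case True
  \<comment> \<open>For w = 1 the base 2 w (w - 1) of the level bound is zero.\<close>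
  have "level_mass j Ls t \<le> 0" if "1 \<le> j" for j
    using order_trans[OF level_mass_le_sum[of j Ls t] sum_spectral_norm_weight[OF assms(1), of j]] that True
    by (simp add: power_0_left)
  then have "(\<Sum>j=1..length Ls. level_mass j Ls t) \<le> 0"
    by (intro sum_nonpos) auto
  then show ?thesis
    by (rule order_trans) simp
next
  case False
  let ?n = "length Ls"
  have "2 \<le> CARD('w)"
    using False zero_less_card_finite[where 'a = 'w] by linarith
  then have w: "2 ^ 2 \<le> real CARD('w) ^ 2"
    by (intro power_mono) auto
  have "(\<Sum>j=1..?n. level_mass j Ls t) \<le>
      (\<Sum>j=1..?n. \<Sum>s\<in>strings_of_weight ?n j. spectral_norm (path_coeff Ls s))"
    by (intro sum_mono level_mass_le_sum)
  also have "\<dots> = (\<Sum>s\<in>bitstrings ?n - {replicate ?n False}. spectral_norm (path_coeff Ls s))"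
    by (rule sum_nonzero_strings[symmetric])
  also have "\<dots> \<le> (\<Sum>s\<in>bitstrings ?n. spectral_norm (path_coeff Ls s))"
    by (intro sum_mono2) auto
  also have "\<dots> \<le> (\<Sum>s\<in>bitstrings ?n. 1)"
    using assms(1) by (intro sum_mono spectral_norm_path_coeff)
  also have "\<dots> = 2 ^ ?n"
    by simp
  also have "\<dots> \<le> (2::real) ^ (2 * k)"
    using assms(2) by (intro power_increasing) auto
  also have "\<dots> = (2 ^ 2) ^ k"
    by (rule power_mult)
  also have "\<dots> \<le> (2 * real CARD('w) ^ 2) ^ k"
    using w by (intro power_mono) auto
  finally show ?thesis .
qed

lemma level_mass_Nil: "1 \<le> j \<Longrightarrow> level_mass j [] t = 0"
  by (auto simp: level_mass_def strings_of_weight_def bitstrings_def intro!: sum.neutral)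

subsection \<open>Random restrictions\<close>

text \<open>The product weights sum to (q False + q True)^n.\<close>

lemma sum_prod_list_bitstrings:
  fixes q :: "bool \<Rightarrow> real"
  assumes "q False + q True = 1"
  shows "(\<Sum>y\<in>bitstrings n. prod_list (map q y)) = 1"
proof (induction n)
  case (Suc n)
  then show ?case
    using assms by (simp add: sum_bitstrings_Suc sum_distrib_left[symmetric])
qed simp

context prob_space
begin

lemma event_count_space:
  assumes "T \<in> measurable M (count_space A)"
  shows "{\<omega> \<in> space M. P (T \<omega>)} \<in> events"
proof -
  have "{\<omega> \<in> space M. P (T \<omega>)} = T -` {x \<in> A. P x} \<inter> space M"
    using measurable_space[OF assms] by auto
  then show ?thesis
    using measurable_sets[OF assms, of "{x \<in> A. P x}"] by simp
qed

text \<open>Almost independence concerns exactly \<open>K\<close> positions, so \<open>I\<close> is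
  padded to that size. The event fixes ones on \<open>I\<close> and leaves the padding free; its
  product weight is \<open>p ^ card I\<close>.\<close>

lemma prob_all_ones_le:
  assumes T: "T \<in> measurable M (count_space (bitstrings n))"
    and bit: "\<And>i. i < n \<Longrightarrow> expectation (\<lambda>\<omega>. of_bool (T \<omega> ! i)) = p"
    and indep: "almost_indep_bits \<delta> K n T"
    and I: "I \<subseteq> {..<n}" "card I \<le> K" and "K \<le> n"
  shows "prob {\<omega> \<in> space M. \<forall>i\<in>I. T \<omega> ! i} \<le> p ^ card I + \<delta>"
proof -
  have "finite I"
    using I(1) finite_subset by blast
  have "K - card I \<le> card ({..<n} - I)"
    using I \<open>K \<le> n\<close> \<open>finite I\<close> by (simp add: card_Diff_subset)
  then obtain J where J: "J \<subseteq> {..<n} - I" "card J = K - card I" "finite J"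
    by (rule obtain_subset_with_card_n)
  define xs ys where "xs = sorted_list_of_set I" and "ys = sorted_list_of_set J"
  define ixs where "ixs = xs @ ys"
  have xs: "set xs = I" "length xs = card I" and ys: "length ys = K - card I"
    using \<open>finite I\<close> J by (auto simp: xs_def ys_def)
  have ixs: "distinct ixs" "set ixs \<subseteq> {..<n}" "length ixs = K"
    using \<open>finite I\<close> J I by (auto simp: ixs_def xs_def ys_def)
  \<comment> \<open>The outcomes on \<open>ixs\<close> that have ones on \<open>I\<close>, listed
    first, and anything on the padding \<open>J\<close>.\<close>
  define S where "S = (@) (replicate (card I) True) ` bitstrings (K - card I)"
  have S: "S \<subseteq> bitstrings K"
    using I by (auto simp: S_def bitstrings_def)
  define q where "q b = (if b then p else 1 - p)" for b
  have q: "prob {\<omega> \<in> space M. T \<omega> ! i = b} = q b" if "i < n" for i b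
  proof -
    have "p = expectation (indicator {\<omega> \<in> space M. T \<omega> ! i})"
      unfolding bit[OF that, symmetric] by (intro Bochner_Integration.integral_cong) (auto simp: indicator_def)
    also have "\<dots> = prob {\<omega> \<in> space M. T \<omega> ! i}"
      by (simp add: event_count_space[OF T, of "\<lambda>x. x ! i"])
    finally show ?thesis
      using prob_neg[OF event_count_space[OF T, of "\<lambda>x. x ! i"]] by (simp add: q_def)
  qed
  have "(\<Sum>x\<in>S. prob {\<omega> \<in> space M. map (\<lambda>i. T \<omega> ! i) ixs = x}) =
      prob (\<Union>x\<in>S. {\<omega> \<in> space M. map (\<lambda>i. T \<omega> ! i) ixs = x})"
  proof (rule finite_measure_finite_Union[symmetric])
    show "finite S"
      by (simp add: S_def)
    show "(\<lambda>x. {\<omega> \<in> space M. map (\<lambda>i. T \<omega> ! i) ixs = x}) ` S \<subseteq> events"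
      using event_count_space[OF T] by auto
  qed (auto simp: disjoint_family_on_def)
  also have "(\<Union>x\<in>S. {\<omega> \<in> space M. map (\<lambda>i. T \<omega> ! i) ixs = x}) =
      {\<omega> \<in> space M. \<forall>i\<in>I. T \<omega> ! i}"
  proof -
    have "(\<exists>x\<in>S. map (\<lambda>i. f i) ixs = x) \<longleftrightarrow> map f xs = replicate (length xs) True" for f
      using ys by (auto simp: S_def ixs_def xs(2) bitstrings_def append_eq_append_conv)
    also have "map f xs = replicate (length xs) True \<longleftrightarrow> (\<forall>i\<in>I. f i)" for f
      unfolding xs(1)[symmetric] by (induction xs) auto
    finally show ?thesis
      by auto
  qed
  finally have joint: "(\<Sum>x\<in>S. prob {\<omega> \<in> space M. map (\<lambda>i. T \<omega> ! i) ixs = x}) =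
      prob {\<omega> \<in> space M. \<forall>i\<in>I. T \<omega> ! i}" .
  have "(\<Prod>l<K. prob {\<omega> \<in> space M. T \<omega> ! (ixs ! l) = x ! l}) = prod_list (map q x)"
    if "x \<in> S" for x
  proof -
    have "(\<Prod>l<K. prob {\<omega> \<in> space M. T \<omega> ! (ixs ! l) = x ! l}) = (\<Prod>l<K. q (x ! l))"
      using ixs by (intro prod.cong q) (auto simp: subset_iff)
    also have "\<dots> = prod_list (map q x)"
      using S that by (auto simp: prod.list_conv_set_nth bitstrings_def atLeast0LessThan)
    finally show ?thesis .
  qed
  then have "(\<Sum>x\<in>S. \<Prod>l<K. prob {\<omega> \<in> space M. T \<omega> ! (ixs ! l) = x ! l}) =
      (\<Sum>x\<in>S. prod_list (map q x))"
    by (rule sum.cong[OF refl])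
  also have "\<dots> = (\<Sum>y\<in>bitstrings (K - card I). p ^ card I * prod_list (map q y))"
    unfolding S_def by (subst sum.reindex) (auto simp: inj_on_def q_def)
  also have "\<dots> = p ^ card I"
    using sum_prod_list_bitstrings[of q] by (simp add: sum_distrib_left[symmetric] q_def)
  finally have "(\<Sum>x\<in>S. \<Prod>l<K. prob {\<omega> \<in> space M. T \<omega> ! (ixs ! l) = x ! l}) = p ^ card I" .
  moreover have "\<bar>\<Sum>x\<in>S. prob {\<omega> \<in> space M. map (\<lambda>i. T \<omega> ! i) ixs = x}
      - (\<Prod>l<K. prob {\<omega> \<in> space M. T \<omega> ! (ixs ! l) = x ! l})\<bar> \<le> \<delta>"
    using indep ixs S unfolding almost_indep_bits_def by blast
  ultimately show ?thesis
    by (simp add: sum_subtractf joint)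
qed

end

section \<open>Expected level mass under a random restriction\<close>

lemma mass_times_probability_le:
  fixes w p \<delta> :: real
  assumes "1 \<le> w" "0 \<le> p" "p \<le> 1 / (2 * w) ^ 2" "\<delta> \<le> 1 / (2 * w) ^ (4 * k)" "j \<le> 2 * k"
  shows "(2 * w ^ 2) ^ j * (p ^ j + \<delta>) \<le> 2 / 2 ^ j"
proof -
  have "p ^ j \<le> (1 / (2 * w) ^ 2) ^ j"
    using assms by (intro power_mono)
  also have "\<dots> = 1 / (2 * w) ^ (2 * j)"
    by (simp only: power_one_over power_mult)
  finally have p: "p ^ j \<le> 1 / (2 * w) ^ (2 * j)" .
  \<comment> \<open>As j \<le> 2k, the error \<delta> obeys the same bound as the main term, so
    together they cost a factor 2.\<close>
  have "(2 * w) ^ (2 * j) \<le> (2 * w) ^ (4 * k)"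
    using assms by (intro power_increasing) auto
  then have "1 / (2 * w) ^ (4 * k) \<le> 1 / (2 * w) ^ (2 * j)"
    using assms by (intro divide_left_mono) auto
  with p assms(4) have "p ^ j + \<delta> \<le> 2 / (2 * w) ^ (2 * j)"
    by linarith
  then have "(2 * w ^ 2) ^ j * (p ^ j + \<delta>) \<le> (2 * w ^ 2) ^ j * (2 / (2 * w) ^ (2 * j))"
    using assms by (intro mult_left_mono) auto
  also have "(2 * w) ^ (2 * j) = (2 * w ^ 2) ^ j * 2 ^ j"
  proof -
    have "(2 * w) ^ 2 = (2 * w ^ 2) * 2"
      by (simp add: power2_eq_square)
    then show ?thesis
      by (simp only: power_mult[of "2 * w" 2 j] power_mult_distrib[of "2 * w ^ 2" 2 j])
  qed
  also have "(2 * w ^ 2) ^ j * (2 / ((2 * w ^ 2) ^ j * 2 ^ j)) = 2 / 2 ^ j"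
    using assms by simp
  finally show ?thesis .
qed

text \<open>Bit m of the infix is bit \<pi>(i + m) of \<open>t\<close>, so survival of
  \<open>s\<close> means that \<open>t\<close> has ones on a fixed set of original
  positions.\<close>

lemma list_all2_infix_iff:
  assumes "\<pi> permutes {..<n}" "length t = n" "length s = length (take l (drop i t))"
  shows "list_all2 (\<longrightarrow>) s (take l (drop i (permute_list \<pi> t))) \<longleftrightarrow>
    (\<forall>x\<in>(\<lambda>m. \<pi> (i + m)) ` {m. m < length s \<and> s ! m}. t ! x)"
  using assms by (auto simp: list_all2_conv_all_nth permute_list_nth)

lemma card_infix_support:
  assumes "\<pi> permutes {..<n}"
  shows "card ((\<lambda>m. \<pi> (i + m)) ` {m. m < length s \<and> s ! m}) = count_list s True"
proof -
  have "inj_on (\<lambda>m. \<pi> (i + m)) {m. m < length s \<and> s ! m}"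
    by (intro inj_onI) (simp add: inj_eq[OF permutes_inj[OF assms]])
  then show ?thesis
    by (simp add: card_image count_list_eq_length_filter length_filter_conv_card)
qed

context prob_space
begin

text \<open>Linearity of expectation: each frequency of weight j survives with probability at most
  \<open>p ^ j + \<delta>\<close>, and their norms add up to at most (2 w^2)^j.\<close>

lemma expectation_level_mass_le:
  fixes Ls :: "('w::finite) prog list" and p \<delta> :: real and i l :: nat
  assumes T: "T \<in> measurable M (count_space (bitstrings n))"
    and bit: "\<And>i. i < n \<Longrightarrow> expectation (\<lambda>\<omega>. of_bool (T \<omega> ! i)) = p"
    and indep: "almost_indep_bits \<delta> K n T"
    and "K \<le> n" "j \<le> K"
    and \<pi>: "\<pi> permutes {..<n}"
    and Ls: "length Ls = n" "\<forall>L\<in>set Ls. regular_layer L"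
    and nonneg: "0 \<le> p ^ j + \<delta>"
  defines "X \<equiv> \<lambda>\<omega>. level_mass j (take l (drop i Ls)) (take l (drop i (permute_list \<pi> (T \<omega>))))"
  shows "integrable M X" "expectation X \<le> (2 * real CARD('w) ^ 2) ^ j * (p ^ j + \<delta>)"
proof -
  define Ks where "Ks = take l (drop i Ls)"
  define N where "N s = spectral_norm (path_coeff Ks s)" for s
  define E where "E s = {\<omega> \<in> space M. list_all2 (\<longrightarrow>) s (take l (drop i (permute_list \<pi> (T \<omega>))))}" for s
  have E: "E s \<in> events" for s
    unfolding E_def by (rule event_count_space[OF T])
  have X: "X \<omega> = (\<Sum>s\<in>strings_of_weight (length Ks) j. indicator (E s) \<omega> * N s)" if "\<omega> \<in> space M" for \<omega>
    using that by (simp add: X_def level_mass_def N_def Ks_def E_def indicator_def cong: sum.cong)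
  have int: "integrable M (\<lambda>\<omega>. indicator (E s) \<omega> * N s)" for s
    by (intro integrable_mult_left integrable_real_indicator E) (simp add: emeasure_eq_measure)
  have "integrable M (\<lambda>\<omega>. \<Sum>s\<in>strings_of_weight (length Ks) j. indicator (E s) \<omega> * N s)"
    by (intro Bochner_Integration.integrable_sum int)
  then show "integrable M X"
    by (simp add: X cong: Bochner_Integration.integrable_cong)
  have "expectation X = expectation (\<lambda>\<omega>. \<Sum>s\<in>strings_of_weight (length Ks) j. indicator (E s) \<omega> * N s)"
    by (intro Bochner_Integration.integral_cong X refl)
  also have "\<dots> = (\<Sum>s\<in>strings_of_weight (length Ks) j. prob (E s) * N s)"
    by (simp only: Bochner_Integration.integral_sum[OF int]) (simp add: E)
  also have "\<dots> \<le> (\<Sum>s\<in>strings_of_weight (length Ks) j. (p ^ j + \<delta>) * N s)"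
  proof (intro sum_mono mult_right_mono)
    fix s
    assume s: "s \<in> strings_of_weight (length Ks) j"
    let ?I = "(\<lambda>m. \<pi> (i + m)) ` {m. m < length s \<and> s ! m}"
    have len: "length s = length Ks" "count_list s True = j"
      using s by (auto simp: strings_of_weight_def bitstrings_def)
    have "T \<omega> \<in> bitstrings n" if "\<omega> \<in> space M" for \<omega>
      using measurable_space[OF T that] by simp
    then have "E s = {\<omega> \<in> space M. \<forall>i\<in>?I. T \<omega> ! i}"
      unfolding E_def using \<pi> len Ls(1)
      by (intro Collect_cong conj_cong refl list_all2_infix_iff) (auto simp: Ks_def bitstrings_def)
    moreover have "?I \<subseteq> {..<n}"
    proof -
      have "?I \<subseteq> \<pi> ` {..<n}"
        using len(1) Ls(1) by (auto simp: Ks_def)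
      then show ?thesis
        by (simp only: permutes_image[OF \<pi>])
    qed
    ultimately show "prob (E s) \<le> p ^ j + \<delta>"
      using prob_all_ones_le[OF T bit indep, of ?I] card_infix_support[OF \<pi>, of i s] len
        \<open>K \<le> n\<close> \<open>j \<le> K\<close> by simp
  qed (simp add: N_def)
  also have "\<dots> = (p ^ j + \<delta>) * (\<Sum>s\<in>strings_of_weight (length Ks) j. N s)"
    by (simp add: sum_distrib_left)
  also have "\<dots> \<le> (p ^ j + \<delta>) * (2 * real CARD('w) ^ 2) ^ j"
    unfolding N_def
    by (intro mult_left_mono nonneg sum_spectral_norm_weight_le)
      (use Ls in \<open>auto simp: Ks_def dest: in_set_takeD in_set_dropD\<close>)
  finally show "expectation X \<le> (2 * real CARD('w) ^ 2) ^ j * (p ^ j + \<delta>)"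
    by (simp add: mult.commute)
qed

end

theorem theorem5p2:
  fixes B :: "('w::finite) prog" and n k :: nat and p \<delta> :: real
    and M :: "'a measure" and T :: "'a \<Rightarrow> bool list"
  assumes "read_once_oblivious_regular n B"
    and "k \<ge> 1"
    and "prob_space M"
    and "T \<in> measurable M (count_space (bitstrings n))"
    and "\<And>i. i < n \<Longrightarrow> prob_space.expectation M (\<lambda>\<omega>. of_bool (T \<omega> ! i)) = p"
    and "prob_space.almost_indep_bits M \<delta> (2 * k) n T"
    and "p \<le> 1 / (2 * real CARD('w)) ^ 2"
    and "\<delta> \<le> 1 / (2 * real CARD('w)) ^ (4 * k)"
  shows "prob_space.prob M
           {\<omega> \<in> space M. L2_mass n (restriction n (prog_matrix B) (T \<omega>)) \<le> (2 * real CARD('w) ^ 2) ^ k}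
         \<ge> 1 - real n ^ 4 * (2 / 2 ^ k)"
proof -
  interpret prob_space M by fact
  note T = assms(4)
  obtain Ls \<pi> where len: "length Ls = n" and reg: "\<forall>L\<in>set Ls. regular_layer L"
    and \<pi>: "\<pi> permutes {..<n}"
    and B: "\<forall>x\<in>bitstrings n. B x = ordered_prog Ls (permute_list \<pi> x)"
    using assms(1) unfolding read_once_oblivious_regular_def by blast
  let ?t = "\<lambda>\<omega>. permute_list \<pi> (T \<omega>)"
  let ?G = "{\<omega> \<in> space M. L2_mass n (restriction n (prog_matrix B) (T \<omega>)) \<le> (2 * real CARD('w) ^ 2) ^ k}"
  have bits: "T \<omega> \<in> bitstrings n" if "\<omega> \<in> space M" for \<omega>
    using measurable_space[OF T that] by simp
  have L2: "L2_mass n (restriction n (prog_matrix B) (T \<omega>)) =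
      (\<Sum>j=1..length Ls. level_mass j Ls (?t \<omega>))" if "\<omega> \<in> space M" for \<omega>
    using L2_mass_restriction[OF \<pi> len B bits[OF that]] len by simp
  show ?thesis
  proof (cases "n < 2 * k")
    case True
    then have "?G = space M"
      using sum_level_mass_le_of_short[OF reg] L2 len by auto
    then show ?thesis
      by (simp add: prob_space)
  next
    case False
    then have n: "2 * k \<le> n" "0 < n"
      using \<open>k \<ge> 1\<close> by auto
    \<comment> \<open>The bit at position 0 exists, and \<open>p\<close> is the expectation of its
      indicator.\<close>
    have p: "0 \<le> p"
      unfolding assms(5)[OF n(2), symmetric] by (intro integral_nonneg_AE) simp
    \<comment> \<open>The empty set of outcomes has discrepancy 0; the index list fits because 2k
      \<le> n.\<close>
    have \<delta>: "0 \<le> \<delta>"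
      using assms(6)[unfolded almost_indep_bits_def, rule_format, of "[0..<2 * k]" "{}"] n by (auto simp: subset_iff)
    let ?X = "\<lambda>i l j \<omega>. level_mass j (take l (drop i Ls)) (take l (drop i (?t \<omega>)))"
    \<comment> \<open>\<open>Suc l\<close> with \<open>l < n\<close> runs through the lengths 1 to
      n, so there are n * n * k events. Empty infixes carry no mass at these levels.\<close>
    let ?E = "\<lambda>(i, l, j). {\<omega> \<in> space M. 1 / n \<le> ?X i (Suc l) j \<omega>}"
    let ?I = "{..<n} \<times> {..<n} \<times> {k..<2 * k}"
    have E: "?E x \<in> events" for x
      unfolding case_prod_beta by (rule event_count_space[OF T])
    have bad: "prob (?E x) \<le> real n * (2 / 2 ^ k)" if "x \<in> ?I" for x
    proof -
      obtain i l j where x: "x = (i, l, j)" and j: "k \<le> j" "j \<le> 2 * k"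
        using \<open>x \<in> ?I\<close> by auto
      have "0 \<le> p ^ j + \<delta>"
        using p \<delta> by simp
      note exp = expectation_level_mass_le[OF T assms(5,6) n(1) j(2) \<pi> len reg this, where i = i and l = "Suc l"]
      \<comment> \<open>Markov's inequality at the threshold \<open>1 / n\<close> produces a factor
        n.\<close>
      have "prob (?E x) \<le> expectation (?X i (Suc l) j) / (1 / n)"
        unfolding x prod.case using n level_mass_nonneg
        by (intro integral_Markov_inequality_measure[where A = "{}"] exp(1)) auto
      also have "\<dots> = real n * expectation (?X i (Suc l) j)"
        by simp
      also have "expectation (?X i (Suc l) j) \<le> (2 * real CARD('w) ^ 2) ^ j * (p ^ j + \<delta>)"
        by (rule exp(2))
      also have "\<dots> \<le> 2 / 2 ^ j"
        using p j assms(7,8) by (intro mass_times_probability_le) (auto simp: Suc_le_eq)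
      also have "\<dots> \<le> 2 / 2 ^ k"
        using j by (intro divide_left_mono power_increasing) auto
      finally show ?thesis
        by (simp add: mult_left_mono)
    qed
    have "space M - ?G \<subseteq> (\<Union>x\<in>?I. ?E x)"
    proof
      fix \<omega>
      assume \<omega>: "\<omega> \<in> space M - ?G"
      show "\<omega> \<in> (\<Union>x\<in>?I. ?E x)"
      proof (rule ccontr)
        assume contra: "\<omega> \<notin> (\<Union>x\<in>?I. ?E x)"
        have "?X i l j \<omega> \<le> 1 / length Ls" if "k \<le> j" "j < 2 * k" for i l j
        proof (cases "i < n \<and> 0 < l")
          case True
          \<comment> \<open>Infixes longer than \<open>n\<close> are cut off at the end of the
            program; the 1 is subtracted to match the index \<open>Suc l'\<close>.\<close>
          define l' where "l' = min l n - 1"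
          have l': "l' < n" and "Suc l' = min l n"
            using True n by (auto simp: l'_def)
          then have "?X i l j \<omega> = ?X i (Suc l') j \<omega>"
            using bits[of \<omega>] \<omega> len by (cases "l \<le> n") (auto simp: bitstrings_def min_def)
          moreover have "(i, l', j) \<in> ?I"
            using True l' that by auto
          then have "\<omega> \<notin> ?E (i, l', j)"
            using contra by blast
          ultimately show ?thesis
            using \<omega> len by auto
        next
          case False
          then have "take l (drop i Ls) = []"
            using len by auto
          then have "?X i l j \<omega> = 0"
            using that \<open>k \<ge> 1\<close> by (simp only: level_mass_Nil)
          then show ?thesis
            by simp
        qed
        then have "(\<Sum>j=1..length Ls. level_mass j Ls (?t \<omega>)) \<le> (2 * real CARD('w) ^ 2) ^ k"
          using bits[of \<omega>] \<omega> len by (intro sum_level_mass_le reg \<open>k \<ge> 1\<close>) (auto simp: bitstrings_def)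
        then show False
          using \<omega> L2 by auto
      qed
    qed
    then have "prob (space M - ?G) \<le> prob (\<Union>x\<in>?I. ?E x)"
      using E by (intro finite_measure_mono sets.finite_UN) auto
    also have "\<dots> \<le> (\<Sum>x\<in>?I. prob (?E x))"
      using E by (intro finite_measure_subadditive_finite) auto
    also have "\<dots> \<le> (\<Sum>x\<in>?I. real n * (2 / 2 ^ k))"
      using bad by (rule sum_mono)
    also have "\<dots> = real n ^ 2 * real k * (real n * (2 / 2 ^ k))"
      by (simp add: power2_eq_square)
    \<comment> \<open>The number of levels \<open>k\<close> is at most \<open>n\<close>, which
      together with the Markov factor makes the fourth power.\<close>
    also have "\<dots> \<le> real n ^ 2 * real n * (real n * (2 / 2 ^ k))"
      using n by (intro mult_right_mono mult_left_mono) auto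
    also have "\<dots> = real n ^ 4 * (2 / 2 ^ k)"
      by (simp add: power2_eq_square power4_eq_xxxx)
    finally have "prob (space M - ?G) \<le> real n ^ 4 * (2 / 2 ^ k)" .
    moreover have "?G \<in> events"
      by (rule event_count_space[OF T])
    ultimately show ?thesis
      using prob_compl[of ?G] by linarith
  qed
qed

end
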